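(* (1) Every almost Alster space is almost Scheepers. (2) Every weakly Alster space is weakly Scheepers.
   Context: For a topological space $X$, let $\mathcal{G}_K$ be the class of all families $\mathcal{U}$ of $G_\delta$ subsets of $X$ such that $X\notin\mathcal{U}$ and every compact set $C\subseteq X$ is contained in some $U\in\mathcal{U}$. $X$ is almost Alster if each $\mathcal{U}\in\mathcal{G}_K$ has a countable subset $\mathcal{V}$ such that $\{\overline{V}:V\in\mathcal{V}\}$ covers $X$. $X$ is weakly Alster if each $\mathcal{U}\in\mathcal{G}_K$ has a countable subset $\mathcal{V}$ such that $\bigcup\mathcal{V}$ is dense in $X$. $X$ is almost Scheepers if for every sequence $(\mathcal{U}_n)_{n\in\mathbb{N}}$ of open covers of $X$ there are finite $\mathcal{V}_n\subseteq\mathcal{U}_n$ such that every finite set $F\subseteq X$ is contained in $\overline{\bigcup\mathcal{V}_n}$ for some $n$. $X$ is weakly Scheepers if for every sequence $(\mathcal{U}_n)_{n\in\mathbb{N}}$ of open covers of $X$ there are finite $\mathcal{V}_n\subseteq\mathcal{U}_n$ such that for every finite collection $\mathcal{F}$ of nonempty open subsets of $X$ there is an $n$ with $U\cap\left(\bigcup\mathcal{V}_n\right)\neq\emptyset$ for all $U\in\mathcal{F}$. *)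

theory Defs
  imports "HOL-Analysis.Analysis"
begin

definition open_cover :: "'a topology \<Rightarrow> 'a set set \<Rightarrow> bool" where
  "open_cover X \<U> \<longleftrightarrow> (\<forall>U\<in>\<U>. openin X U) \<and> \<Union>\<U> = topspace X"

definition gdelta_compact_families :: "'a topology \<Rightarrow> 'a set set set" where
  "gdelta_compact_families X =
    {\<U>. (\<forall>U\<in>\<U>. gdelta_in X U) \<and> topspace X \<notin> \<U> \<and>
         (\<forall>C. compactin X C \<longrightarrow> (\<exists>U\<in>\<U>. C \<subseteq> U))}"

definition almost_Alster :: "'a topology \<Rightarrow> bool" where
  "almost_Alster X \<longleftrightarrow>
    (\<forall>\<U>\<in>gdelta_compact_families X.
      \<exists>\<V>. \<V> \<subseteq> \<U> \<and> countable \<V> \<and> (\<Union>V\<in>\<V>. X closure_of V) = topspace X)"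

definition weakly_Alster :: "'a topology \<Rightarrow> bool" where
  "weakly_Alster X \<longleftrightarrow>
    (\<forall>\<U>\<in>gdelta_compact_families X.
      \<exists>\<V>. \<V> \<subseteq> \<U> \<and> countable \<V> \<and> X closure_of (\<Union>\<V>) = topspace X)"

definition almost_Scheepers :: "'a topology \<Rightarrow> bool" where
  "almost_Scheepers X \<longleftrightarrow>
    (\<forall>\<U>::nat \<Rightarrow> 'a set set. (\<forall>n. open_cover X (\<U> n)) \<longrightarrow>
      (\<exists>\<V>::nat \<Rightarrow> 'a set set. (\<forall>n. finite (\<V> n) \<and> \<V> n \<subseteq> \<U> n) \<and>
        (\<forall>F. finite F \<and> F \<subseteq> topspace X \<longrightarrow> (\<exists>n. F \<subseteq> X closure_of (\<Union>(\<V> n))))))"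

definition weakly_Scheepers :: "'a topology \<Rightarrow> bool" where
  "weakly_Scheepers X \<longleftrightarrow>
    (\<forall>\<U>::nat \<Rightarrow> 'a set set. (\<forall>n. open_cover X (\<U> n)) \<longrightarrow>
      (\<exists>\<V>::nat \<Rightarrow> 'a set set. (\<forall>n. finite (\<V> n) \<and> \<V> n \<subseteq> \<U> n) \<and>
        (\<forall>\<F>. finite \<F> \<and> (\<forall>U\<in>\<F>. openin X U \<and> U \<noteq> {}) \<longrightarrow>
          (\<exists>n. \<forall>U\<in>\<F>. U \<inter> \<Union>(\<V> n) \<noteq> {}))))"

end

theory Submission
  imports Defs
begin

text \<open>Given open covers \<open>\<U>\<^sub>n\<close>, choose for every compact \<open>C\<close> finite \<open>\<A>\<^sub>n(C) \<subseteq> \<U>\<^sub>n\<close> covering \<open>C\<close>.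
  The sets \<open>G(C) = \<Inter>\<^sub>n \<Union>\<A>\<^sub>n(C)\<close> are \<open>G\<^sub>\<delta>\<close> sets to which the Alster property applies, unless some
  \<open>G(C)\<close> is the whole space, in which case \<open>\<A>\<^sub>n(C)\<close> is already a finite subcover of each \<open>\<U>\<^sub>n\<close>.
  A countable selection \<open>G(C\<^sub>0), G(C\<^sub>1), \<dots>\<close> yields \<open>\<V>\<^sub>n = \<A>\<^sub>n(C\<^sub>0) \<union> \<dots> \<union> \<A>\<^sub>n(C\<^sub>n)\<close>, and each \<open>G(C\<^sub>k)\<close> lies
  in all but finitely many of the \<open>\<Union>\<V>\<^sub>n\<close>; so finitely many requirements are met by a common \<open>n\<close>.\<close>

text \<open>The family \<open>\<G>\<close> is fixed before \<open>\<H>\<close>, so either Alster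
  property may choose \<open>\<H>\<close> from it. Absorption holds for almost all \<open>n\<close>,
  not just for some \<open>n\<close>, so that finitely many such conditions can be met at
  once.\<close>

lemma eventually_absorbing_selection:
  fixes \<U> :: "nat \<Rightarrow> 'a set set"
  assumes cover: "\<And>n. open_cover X (\<U> n)"
    and no_subcover: "\<nexists>\<V>. \<forall>n. finite (\<V> n) \<and> \<V> n \<subseteq> \<U> n \<and> \<Union>(\<V> n) = topspace X"
  shows "\<exists>\<G>\<in>gdelta_compact_families X. \<forall>\<H>. \<H> \<subseteq> \<G> \<and> countable \<H> \<longrightarrow>
    (\<exists>\<V>. (\<forall>n. finite (\<V> n) \<and> \<V> n \<subseteq> \<U> n) \<and> (\<forall>H\<in>\<H>. \<forall>\<^sub>F n in sequentially. H \<subseteq> \<Union>(\<V> n)))"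
proof -
  \<comment> \<open>Compactness stands inside the existential so that choice gives a total function
    of \<open>n\<close> and \<open>C\<close>.\<close>
  have "\<forall>n C. \<exists>\<A>. compactin X C \<longrightarrow> finite \<A> \<and> \<A> \<subseteq> \<U> n \<and> C \<subseteq> \<Union>\<A>"
    using cover unfolding compactin_def open_cover_def by auto
  then obtain \<A> where "\<forall>n C. compactin X C \<longrightarrow> finite (\<A> n C) \<and> \<A> n C \<subseteq> \<U> n \<and> C \<subseteq> \<Union>(\<A> n C)"
    unfolding choice_iff by blast
  then have \<A>: "finite (\<A> n C) \<and> \<A> n C \<subseteq> \<U> n \<and> C \<subseteq> \<Union>(\<A> n C)" if "compactin X C" for n C
    using that by blast
  define G where "G C = (\<Inter>n. \<Union>(\<A> n C))" for C
  have open_\<A>: "openin X (\<Union>(\<A> n C))" if "compactin X C" for n C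
    using \<A>[OF that, of n] cover[of n] unfolding open_cover_def by blast
  have "gdelta_in X (G C)" if "compactin X C" for C
    unfolding G_def using open_\<A>[OF that] by (intro gdelta_in_Inter) (auto intro: open_imp_gdelta_in)
  moreover have "G C \<noteq> topspace X" if C: "compactin X C" for C
  proof
    assume "G C = topspace X"
    \<comment> \<open>\<open>G C\<close> lies in every \<open>\<Union>(\<A> n C)\<close>. If it is
      the whole space, so are all these unions, and \<open>\<lambda>n. \<A> n C\<close> is a
      sequence excluded by \<open>no_subcover\<close>.\<close>
    then have "\<Union>(\<A> n C) = topspace X" for n
      using openin_subset[OF open_\<A>[OF C, of n]] unfolding G_def by blast
    then have "\<forall>n. finite (\<A> n C) \<and> \<A> n C \<subseteq> \<U> n \<and> \<Union>(\<A> n C) = topspace X"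
      using \<A>[OF C] by simp
    with no_subcover show False by (simp add: exI[of _ "\<lambda>n. \<A> n C"])
  qed
  moreover have "C \<subseteq> G C" if "compactin X C" for C
    using \<A>[OF that] unfolding G_def by blast
  ultimately have "G ` Collect (compactin X) \<in> gdelta_compact_families X"
    unfolding gdelta_compact_families_def by fastforce
  moreover have "\<exists>\<V>. (\<forall>n. finite (\<V> n) \<and> \<V> n \<subseteq> \<U> n) \<and>
      (\<forall>H\<in>\<H>. \<forall>\<^sub>F n in sequentially. H \<subseteq> \<Union>(\<V> n))"
    if "\<H> \<subseteq> G ` Collect (compactin X)" "countable \<H>" for \<H>
  proof -
    \<comment> \<open>The compact sets are enumerated rather than their images under
      \<open>G\<close>, since \<open>\<A>\<close> depends on the compact set and \<open>G\<close>
      need not be injective.\<close>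
    obtain \<C> where \<C>: "\<C> \<subseteq> Collect (compactin X)" "countable \<C>" "\<H> = G ` \<C>"
      using \<open>\<H> \<subseteq> _\<close> \<open>countable \<H>\<close> by (metis countable_subset_image)
    \<comment> \<open>The empty set is added only to make the enumerated set nonempty.\<close>
    define C where "C = from_nat_into (insert {} \<C>)"
    have range_C: "range C = insert {} \<C>"
      unfolding C_def using \<open>countable \<C>\<close> by (simp add: range_from_nat_into)
    then have compact_C: "compactin X (C k)" for k
      using \<C>(1) by (metis compactin_empty insertE mem_Collect_eq rangeI subsetD)
    \<comment> \<open>Cutting off at \<open>k \<le> n\<close> keeps \<open>\<V> n\<close> finite,
      while each fixed \<open>k\<close> contributes from stage \<open>k\<close> on.\<close>
    define \<V> where "\<V> n = (\<Union>k\<le>n. \<A> n (C k))" for n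
    have "finite (\<V> n) \<and> \<V> n \<subseteq> \<U> n" for n
      unfolding \<V>_def using \<A>[OF compact_C] by blast
    moreover have "\<forall>\<^sub>F n in sequentially. H \<subseteq> \<Union>(\<V> n)" if "H \<in> \<H>" for H
    proof -
      have "H \<in> G ` range C"
        using that \<C>(3) range_C by auto
      then obtain k where H: "H = G (C k)"
        by auto
      have "H \<subseteq> \<Union>(\<V> n)" if "k \<le> n" for n
      proof -
        have "H \<subseteq> \<Union>(\<A> n (C k))"
          unfolding H G_def by (rule INF_lower) simp
        also have "\<dots> \<subseteq> \<Union>(\<V> n)"
          unfolding \<V>_def using that by (intro Union_mono UN_upper) simp
        finally show ?thesis .
      qed
      then show ?thesis
        unfolding eventually_sequentially by blast
    qed
    ultimately show ?thesis by (intro exI[of _ \<V>]) simp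
  qed
  ultimately show ?thesis by blast
qed

text \<open>Each point lies in the closure of a single selected \<open>H\<close>. Closure is
  monotone, so the point stays in the closure of \<open>\<Union>(\<V> n)\<close> for all large
  \<open>n\<close>.\<close>

lemma almost_Alster_imp_almost_Scheepers:
  assumes "almost_Alster X"
  shows "almost_Scheepers X"
  unfolding almost_Scheepers_def
proof (intro allI impI)
  fix \<U> :: "nat \<Rightarrow> 'a set set"
  assume cover: "\<forall>n. open_cover X (\<U> n)"
  show "\<exists>\<V>. (\<forall>n. finite (\<V> n) \<and> \<V> n \<subseteq> \<U> n) \<and>
    (\<forall>F. finite F \<and> F \<subseteq> topspace X \<longrightarrow> (\<exists>n. F \<subseteq> X closure_of \<Union>(\<V> n)))"
  proof (cases "\<exists>\<V>. \<forall>n. finite (\<V> n) \<and> \<V> n \<subseteq> \<U> n \<and> \<Union>(\<V> n) = topspace X")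
    case True
    then obtain \<V> where "\<forall>n. finite (\<V> n) \<and> \<V> n \<subseteq> \<U> n \<and> \<Union>(\<V> n) = topspace X"
      by (elim exE)
    then show ?thesis by (intro exI[of _ \<V>]) simp
  next
    case False
    obtain \<G> where \<G>: "\<G> \<in> gdelta_compact_families X"
      "\<forall>\<H>. \<H> \<subseteq> \<G> \<and> countable \<H> \<longrightarrow>
        (\<exists>\<V>. (\<forall>n. finite (\<V> n) \<and> \<V> n \<subseteq> \<U> n) \<and> (\<forall>H\<in>\<H>. \<forall>\<^sub>F n in sequentially. H \<subseteq> \<Union>(\<V> n)))"
      using eventually_absorbing_selection[OF cover[rule_format] False] by (elim bexE)
    obtain \<H> where \<H>: "\<H> \<subseteq> \<G>" "countable \<H>" "(\<Union>H\<in>\<H>. X closure_of H) = topspace X"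
      using bspec[OF assms[unfolded almost_Alster_def] \<G>(1)] by (elim exE conjE)
    obtain \<V> where \<V>: "\<forall>n. finite (\<V> n) \<and> \<V> n \<subseteq> \<U> n"
      "\<forall>H\<in>\<H>. \<forall>\<^sub>F n in sequentially. H \<subseteq> \<Union>(\<V> n)"
      using \<G>(2)[rule_format, OF conjI[OF \<H>(1,2)]] by (elim exE conjE)
    have "\<exists>n. F \<subseteq> X closure_of \<Union>(\<V> n)" if F: "finite F" "F \<subseteq> topspace X" for F
    proof -
      have "\<forall>\<^sub>F n in sequentially. x \<in> X closure_of \<Union>(\<V> n)" if "x \<in> F" for x
      proof -
        have "x \<in> (\<Union>H\<in>\<H>. X closure_of H)"
          using that F(2) \<H>(3) by auto
        then obtain H where H: "H \<in> \<H>" "x \<in> X closure_of H"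
          by (elim UN_E)
        show ?thesis
          using \<V>(2)[rule_format, OF H(1)]
          by (rule eventually_mono) (rule subsetD[OF closure_of_mono H(2)])
      qed
      \<comment> \<open>Finiteness of \<open>F\<close> enters here: the thresholds of its points
        have a common upper bound.\<close>
      then have "\<forall>\<^sub>F n in sequentially. \<forall>x\<in>F. x \<in> X closure_of \<Union>(\<V> n)"
        using F by (simp add: eventually_ball_finite)
      then show ?thesis
        unfolding eventually_sequentially by blast
    qed
    with \<V>(1) show ?thesis by (intro exI[of _ \<V>]) simp
  qed
qed

text \<open>Same scheme, with meeting \<open>U\<close> in place of having a point in the closure:
  this property also passes to supersets, and density supplies an \<open>H\<close> that has
  it.\<close>

lemma weakly_Alster_imp_weakly_Scheepers:
  assumes "weakly_Alster X"
  shows "weakly_Scheepers X"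
  unfolding weakly_Scheepers_def
proof (intro allI impI)
  fix \<U> :: "nat \<Rightarrow> 'a set set"
  assume cover: "\<forall>n. open_cover X (\<U> n)"
  show "\<exists>\<V>. (\<forall>n. finite (\<V> n) \<and> \<V> n \<subseteq> \<U> n) \<and>
    (\<forall>\<F>. finite \<F> \<and> (\<forall>U\<in>\<F>. openin X U \<and> U \<noteq> {}) \<longrightarrow> (\<exists>n. \<forall>U\<in>\<F>. U \<inter> \<Union>(\<V> n) \<noteq> {}))"
  proof (cases "\<exists>\<V>. \<forall>n. finite (\<V> n) \<and> \<V> n \<subseteq> \<U> n \<and> \<Union>(\<V> n) = topspace X")
    case True
    then obtain \<V> where "\<forall>n. finite (\<V> n) \<and> \<V> n \<subseteq> \<U> n \<and> \<Union>(\<V> n) = topspace X"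
      by (elim exE)
    \<comment> \<open>If every \<open>\<Union>(\<V> n)\<close> is the whole space, its intersection
      with an open \<open>U\<close> is \<open>U\<close> itself, which is nonempty.\<close>
    then show ?thesis by (intro exI[of _ \<V>]) (auto simp: inf.absorb1 openin_subset)
  next
    case False
    obtain \<G> where \<G>: "\<G> \<in> gdelta_compact_families X"
      "\<forall>\<H>. \<H> \<subseteq> \<G> \<and> countable \<H> \<longrightarrow>
        (\<exists>\<V>. (\<forall>n. finite (\<V> n) \<and> \<V> n \<subseteq> \<U> n) \<and> (\<forall>H\<in>\<H>. \<forall>\<^sub>F n in sequentially. H \<subseteq> \<Union>(\<V> n)))"
      using eventually_absorbing_selection[OF cover[rule_format] False] by (elim bexE)
    obtain \<H> where \<H>: "\<H> \<subseteq> \<G>" "countable \<H>" "X closure_of \<Union>\<H> = topspace X"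
      using bspec[OF assms[unfolded weakly_Alster_def] \<G>(1)] by (elim exE conjE)
    obtain \<V> where \<V>: "\<forall>n. finite (\<V> n) \<and> \<V> n \<subseteq> \<U> n"
      "\<forall>H\<in>\<H>. \<forall>\<^sub>F n in sequentially. H \<subseteq> \<Union>(\<V> n)"
      using \<G>(2)[rule_format, OF conjI[OF \<H>(1,2)]] by (elim exE conjE)
    have "\<exists>n. \<forall>U\<in>\<F>. U \<inter> \<Union>(\<V> n) \<noteq> {}"
      if \<F>: "finite \<F>" "\<forall>U\<in>\<F>. openin X U \<and> U \<noteq> {}" for \<F>
    proof -
      have "\<forall>\<^sub>F n in sequentially. U \<inter> \<Union>(\<V> n) \<noteq> {}" if "U \<in> \<F>" for U
      proof -
        \<comment> \<open>The dense union meets \<open>U\<close>, and any common point already lies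
          in one member of \<open>\<H>\<close>.\<close>
        have "U \<inter> \<Union>\<H> \<noteq> {}"
          using that \<F>(2) \<H>(3)[unfolded dense_intersects_open] by (simp add: Int_commute)
        then obtain H where H: "H \<in> \<H>" "U \<inter> H \<noteq> {}" by blast
        show ?thesis
          using \<V>(2)[rule_format, OF H(1)]
          by (rule eventually_mono) (use H(2) in blast)
      qed
      then have "\<forall>\<^sub>F n in sequentially. \<forall>U\<in>\<F>. U \<inter> \<Union>(\<V> n) \<noteq> {}"
        using \<F>(1) by (simp add: eventually_ball_finite)
      then show ?thesis
        unfolding eventually_sequentially by blast
    qed
    with \<V>(1) show ?thesis by (intro exI[of _ \<V>]) simp
  qed
qed

theorem theorem3p7:
  shows "(\<forall>X :: 'a topology. almost_Alster X \<longrightarrow> almost_Scheepers X) \<and>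
         (\<forall>X :: 'a topology. weakly_Alster X \<longrightarrow> weakly_Scheepers X)"
  by (simp add: almost_Alster_imp_almost_Scheepers weakly_Alster_imp_weakly_Scheepers)

end
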